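(* Let $(X_n)_{n=1}^\infty$ be a sequence of separable Banach spaces with uniformly summable Szlenk index, i.e. there is a constant $M$ such that every $X_n$ has summable Szlenk index with constant $M$. Then the Banach space $X=\left(\bigoplus_{n=1}^\infty X_n\right)_{c_0}$ has summable Szlenk index.
   Context: For a Banach space $X$, a weak$^*$-compact set $K\subset X^*$ and $\varepsilon>0$, the $\varepsilon$-Szlenk derivation of $K$ is $$\iota_\varepsilon K=\{x^*\in K:\ \mathrm{diam}(K\cap U)>\varepsilon \text{ for every weak}^*\text{-open neighborhood } U \text{ of } x^*\},$$ where the diameter is taken in the norm of $X^*$. Let $B_{X^*}$ be the closed unit ball of $X^*$. We say that $X$ has summable Szlenk index with constant $M$ if for all $n\in\mathbb{N}$ and all positive $\varepsilon_1,\ldots,\varepsilon_n$ with $\iota_{\varepsilon_1}\cdots\iota_{\varepsilon_n}B_{X^*}\neq\varnothing$ one has $\sum_{i=1}^n\varepsilon_i\leq M$. We say that $X$ has summable Szlenk index if this holds for some constant $M$. $\left(\bigoplus_{n=1}^\infty X_n\right)_{c_0}$ is the space of all sequences $(x_n)$ with $x_n\in X_n$ and $\|x_n\|\to 0$, normed by $\sup_n\|x_n\|$. *)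

theory Defs
  imports "HOL-Analysis.Analysis"
begin

section \<open>Real Banach spaces with an explicit carrier\<close>

text \<open>A sequence \<open>(X\<^sub>n)\<close> of possibly different Banach spaces cannot be a sequence of types, so a
  space is a record, and the spaces of a sequence only share the type in which their carriers live;
  their operations and norms are unrelated.\<close>

record 'a nspace =
  vecs :: "'a set"
  vadd :: "'a \<Rightarrow> 'a \<Rightarrow> 'a"
  vzero :: "'a"
  vscale :: "real \<Rightarrow> 'a \<Rightarrow> 'a"
  vnorm :: "'a \<Rightarrow> real"

text \<open>The locale \<open>Metric_space\<close> constrains its distance function off the carrier as well; hence
  the guard.\<close>

definition vdist :: "'a nspace \<Rightarrow> 'a \<Rightarrow> 'a \<Rightarrow> real" where
  "vdist X x y =
     (if x \<in> vecs X \<and> y \<in> vecs X then vnorm X (vadd X x (vscale X (- 1) y)) else 0)"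

locale real_nspace =
  fixes X :: "'a nspace"
  assumes add_closed: "\<lbrakk>x \<in> vecs X; y \<in> vecs X\<rbrakk> \<Longrightarrow> vadd X x y \<in> vecs X"
    and zero_closed: "vzero X \<in> vecs X"
    and scale_closed: "x \<in> vecs X \<Longrightarrow> vscale X c x \<in> vecs X"
    and add_assoc: "\<lbrakk>x \<in> vecs X; y \<in> vecs X; z \<in> vecs X\<rbrakk> \<Longrightarrow>
          vadd X (vadd X x y) z = vadd X x (vadd X y z)"
    and add_commute: "\<lbrakk>x \<in> vecs X; y \<in> vecs X\<rbrakk> \<Longrightarrow> vadd X x y = vadd X y x"
    and add_zero: "x \<in> vecs X \<Longrightarrow> vadd X x (vzero X) = x"
    and add_inverse: "x \<in> vecs X \<Longrightarrow> \<exists>y\<in>vecs X. vadd X x y = vzero X"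
    and scale_add_right: "\<lbrakk>x \<in> vecs X; y \<in> vecs X\<rbrakk> \<Longrightarrow>
          vscale X c (vadd X x y) = vadd X (vscale X c x) (vscale X c y)"
    and scale_add_left: "x \<in> vecs X \<Longrightarrow>
          vscale X (c + d) x = vadd X (vscale X c x) (vscale X d x)"
    and scale_scale: "x \<in> vecs X \<Longrightarrow> vscale X c (vscale X d x) = vscale X (c * d) x"
    and scale_one: "x \<in> vecs X \<Longrightarrow> vscale X 1 x = x"
    and norm_nonneg: "x \<in> vecs X \<Longrightarrow> 0 \<le> vnorm X x"
    and norm_eq_zero: "x \<in> vecs X \<Longrightarrow> vnorm X x = 0 \<longleftrightarrow> x = vzero X"
    and norm_scale: "x \<in> vecs X \<Longrightarrow> vnorm X (vscale X c x) = \<bar>c\<bar> * vnorm X x"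
    and norm_triangle: "\<lbrakk>x \<in> vecs X; y \<in> vecs X\<rbrakk> \<Longrightarrow>
          vnorm X (vadd X x y) \<le> vnorm X x + vnorm X y"

locale banach_nspace = real_nspace +
  assumes complete: "Metric_space.mcomplete (vecs X) (vdist X)"

definition separable_nspace :: "'a nspace \<Rightarrow> bool" where
  "separable_nspace X \<longleftrightarrow> separable_space (Metric_space.mtopology (vecs X) (vdist X))"


section \<open>The dual space and its weak* topology\<close>

text \<open>Functionals are normalised to be \<^const>\<open>undefined\<close> off the carrier, as everywhere in
  \<^const>\<open>PiE\<close>, so that functionals agreeing on the space are equal.\<close>

definition dual :: "'a nspace \<Rightarrow> ('a \<Rightarrow> real) set" where
  "dual X = {f \<in> extensional (vecs X).
     (\<forall>x\<in>vecs X. \<forall>y\<in>vecs X. f (vadd X x y) = f x + f y) \<and>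
     (\<forall>x\<in>vecs X. \<forall>c. f (vscale X c x) = c * f x) \<and>
     (\<exists>C. \<forall>x\<in>vecs X. \<bar>f x\<bar> \<le> C * vnorm X x)}"

definition dual_norm :: "'a nspace \<Rightarrow> ('a \<Rightarrow> real) \<Rightarrow> real" where
  "dual_norm X f = (SUP x\<in>{x \<in> vecs X. vnorm X x \<le> 1}. \<bar>f x\<bar>)"

definition dual_ball :: "'a nspace \<Rightarrow> ('a \<Rightarrow> real) set" where
  "dual_ball X = {f \<in> dual X. dual_norm X f \<le> 1}"

text \<open>The topology of pointwise convergence on the space.\<close>

definition weak_star :: "'a nspace \<Rightarrow> ('a \<Rightarrow> real) topology" where
  "weak_star X = subtopology (product_topology (\<lambda>_. euclideanreal) (vecs X)) (dual X)"

text \<open>The difference below is not \<^const>\<open>extensional\<close>, but \<^const>\<open>dual_norm\<close> only looks at the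
  carrier. The supremum is taken in \<^typ>\<open>ennreal\<close> so that unbounded sets have infinite diameter.\<close>

definition dual_diam :: "'a nspace \<Rightarrow> ('a \<Rightarrow> real) set \<Rightarrow> ennreal" where
  "dual_diam X A = (SUP f\<in>A. SUP g\<in>A. ennreal (dual_norm X (\<lambda>x. f x - g x)))"


section \<open>Szlenk derivations and summable Szlenk index\<close>

definition szlenk :: "'a nspace \<Rightarrow> real \<Rightarrow> ('a \<Rightarrow> real) set \<Rightarrow> ('a \<Rightarrow> real) set" where
  "szlenk X e K = {f \<in> K. \<forall>U. openin (weak_star X) U \<and> f \<in> U \<longrightarrow> dual_diam X (K \<inter> U) > ennreal e}"

text \<open>\<open>foldr (szlenk X) [e\<^sub>1, \<dots>, e\<^sub>n] K\<close> is \<open>szlenk X e\<^sub>1 (\<dots> (szlenk X e\<^sub>n K))\<close>.\<close>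

definition summable_szlenk_with :: "real \<Rightarrow> 'a nspace \<Rightarrow> bool" where
  "summable_szlenk_with M X \<longleftrightarrow>
     (\<forall>es. es \<noteq> [] \<and> (\<forall>e\<in>set es. 0 < e) \<and> foldr (szlenk X) es (dual_ball X) \<noteq> {}
        \<longrightarrow> sum_list es \<le> M)"

definition summable_szlenk :: "'a nspace \<Rightarrow> bool" where
  "summable_szlenk X \<longleftrightarrow> (\<exists>M. summable_szlenk_with M X)"


section \<open>The \<open>c\<^sub>0\<close>-sum\<close>

definition c0_sum :: "(nat \<Rightarrow> 'a nspace) \<Rightarrow> (nat \<Rightarrow> 'a) nspace" where
  "c0_sum X = \<lparr>
     vecs = {x. (\<forall>n. x n \<in> vecs (X n)) \<and> (\<lambda>n. vnorm (X n) (x n)) \<longlonglongrightarrow> 0},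
     vadd = (\<lambda>x y n. vadd (X n) (x n) (y n)),
     vzero = (\<lambda>n. vzero (X n)),
     vscale = (\<lambda>c x n. vscale (X n) c (x n)),
     vnorm = (\<lambda>x. SUP n. vnorm (X n) (x n)) \<rparr>"

context real_nspace
begin

lemma scale_zero_left:
  assumes x: "x \<in> vecs X"
  shows "vscale X 0 x = vzero X"
  using norm_eq_zero[OF scale_closed[OF x, of 0]] norm_scale[OF x, of 0] by simp

lemma add_minus:
  assumes x: "x \<in> vecs X"
  shows "vadd X x (vscale X (- 1) x) = vzero X"
  using scale_add_left[OF x, of 1 "- 1"] scale_zero_left[OF x] scale_one[OF x] by simp

lemma vdist_diff_triangle:
  assumes "x \<in> vecs X" "y \<in> vecs X" "z \<in> vecs X"
  shows "vadd X x (vscale X (- 1) z) =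
         vadd X (vadd X x (vscale X (- 1) y)) (vadd X y (vscale X (- 1) z))"
proof -
  let ?m = "vscale X (- 1)"
  note cl = assms add_closed scale_closed zero_closed
  have "vadd X (vadd X x (?m y)) (vadd X y (?m z)) = vadd X x (vadd X (?m y) (vadd X y (?m z)))"
    using cl by (simp add: add_assoc)
  also have "vadd X (?m y) (vadd X y (?m z)) = vadd X (vadd X (?m y) y) (?m z)"
    using cl by (simp add: add_assoc)
  also have "vadd X (?m y) y = vadd X y (?m y)"
    using cl by (intro add_commute)
  also have "vadd X (vadd X y (?m y)) (?m z) = ?m z"
    using cl by (simp add: add_minus add_commute[of "vzero X" "?m z"] add_zero)
  finally show ?thesis by simp
qed

lemma vdist_commute: "vdist X x y = vdist X y x"
proof (cases "x \<in> vecs X \<and> y \<in> vecs X")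
  case True
  then have "vscale X (- 1) (vadd X x (vscale X (- 1) y)) = vadd X y (vscale X (- 1) x)"
    by (simp add: scale_add_right scale_closed scale_scale scale_one add_commute)
  with True show ?thesis
    unfolding vdist_def
    by (metis norm_scale add_closed scale_closed abs_minus abs_one mult_1)
qed (auto simp: vdist_def)

lemma metric: "Metric_space (vecs X) (vdist X)"
proof
  show "0 \<le> vdist X x y" for x y
    by (simp add: vdist_def norm_nonneg add_closed scale_closed)
  show "vdist X x y = vdist X y x" for x y
    by (rule vdist_commute)
  show "vdist X x y = 0 \<longleftrightarrow> x = y" if xy: "x \<in> vecs X" "y \<in> vecs X" for x y
  proof
    assume "vdist X x y = 0"
    then have z: "vadd X x (vscale X (- 1) y) = vzero X"
      using xy by (simp add: vdist_def norm_eq_zero add_closed scale_closed)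
    have "vadd X (vadd X x (vscale X (- 1) y)) y = vadd X x (vadd X y (vscale X (- 1) y))"
      using xy by (simp add: add_assoc scale_closed add_commute)
    then show "x = y"
      using xy by (simp add: z add_minus add_zero add_commute[of "vzero X"] zero_closed)
  next
    assume "x = y"
    then show "vdist X x y = 0"
      using xy by (simp add: vdist_def add_minus norm_eq_zero zero_closed)
  qed
  show "vdist X x z \<le> vdist X x y + vdist X y z"
    if "x \<in> vecs X" "y \<in> vecs X" "z \<in> vecs X" for x y z
    using that vdist_diff_triangle[OF that]
    by (simp add: vdist_def norm_triangle add_closed scale_closed)
qed

end

lemma c0_sum_norm_bdd: "x \<in> vecs (c0_sum X) \<Longrightarrow> bdd_above (range (\<lambda>n. vnorm (X n) (x n)))"
  unfolding c0_sum_def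
  by (auto intro!: bounded_imp_bdd_above convergent_imp_bounded)

lemma c0_sum_norm_ge: "x \<in> vecs (c0_sum X) \<Longrightarrow> vnorm (X n) (x n) \<le> vnorm (c0_sum X) x"
  using cSUP_upper[OF _ c0_sum_norm_bdd] by (fastforce simp: c0_sum_def)

lemma c0_sum_norm_le: "(\<And>n. vnorm (X n) (x n) \<le> C) \<Longrightarrow> vnorm (c0_sum X) x \<le> C"
  by (auto simp: c0_sum_def intro: cSUP_least)

lemma real_nspace_c0_sum:
  assumes "\<And>n. real_nspace (X n)"
  shows "real_nspace (c0_sum X)"
proof -
  interpret S: real_nspace "X n" for n by (rule assms)
  have add: "vadd (c0_sum X) x y \<in> vecs (c0_sum X)"
    if "x \<in> vecs (c0_sum X)" "y \<in> vecs (c0_sum X)" for x y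
  proof -
    have xy: "x n \<in> vecs (X n)" "y n \<in> vecs (X n)" for n
      using that by (auto simp: c0_sum_def)
    have l: "(\<lambda>n. vnorm (X n) (x n) + vnorm (X n) (y n)) \<longlonglongrightarrow> 0"
      using that tendsto_add[of "\<lambda>n. vnorm (X n) (x n)" 0 sequentially "\<lambda>n. vnorm (X n) (y n)" 0]
      by (simp add: c0_sum_def)
    have "(\<lambda>n. vnorm (X n) (vadd (X n) (x n) (y n))) \<longlonglongrightarrow> 0"
      by (rule tendsto_sandwich[OF _ _ tendsto_const l])
         (auto simp: S.norm_nonneg S.add_closed S.norm_triangle xy)
    then show ?thesis using xy by (simp add: c0_sum_def S.add_closed)
  qed
  have sc: "vscale (c0_sum X) c x \<in> vecs (c0_sum X)" if "x \<in> vecs (c0_sum X)" for c x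
    using that tendsto_mult_right_zero[of "\<lambda>n. vnorm (X n) (x n)" sequentially "\<bar>c\<bar>"]
    by (simp add: c0_sum_def S.scale_closed S.norm_scale)
  have ze: "vzero (c0_sum X) \<in> vecs (c0_sum X)"
    using S.norm_eq_zero[OF S.zero_closed] by (simp add: c0_sum_def S.zero_closed)
  have mem: "x n \<in> vecs (X n)" if "x \<in> vecs (c0_sum X)" for x n
    using that by (simp add: c0_sum_def)
  have app: "vadd (c0_sum X) x y n = vadd (X n) (x n) (y n)"
    "vscale (c0_sum X) c x n = vscale (X n) c (x n)"
    "vzero (c0_sum X) n = vzero (X n)" for x y c n
    by (simp_all add: c0_sum_def)
  have nn: "0 \<le> vnorm (c0_sum X) x" if "x \<in> vecs (c0_sum X)" for x
    using order_trans[OF S.norm_nonneg[OF mem[OF that]] c0_sum_norm_ge[OF that]] .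
  have ns: "vnorm (c0_sum X) (vscale (c0_sum X) c x) \<le> \<bar>c\<bar> * vnorm (c0_sum X) x"
    if "x \<in> vecs (c0_sum X)" for c x
    using that by (auto intro!: c0_sum_norm_le mult_left_mono c0_sum_norm_ge
        simp: app S.norm_scale mem)
  show ?thesis
  proof
    fix x y z c d
    assume x: "x \<in> vecs (c0_sum X)"
    note mx = mem[OF x]
    show "\<exists>y\<in>vecs (c0_sum X). vadd (c0_sum X) x y = vzero (c0_sum X)"
      by (rule bexI[OF _ sc[OF x, of "- 1"]]) (auto simp: fun_eq_iff app S.add_minus mx)
    show "vadd (c0_sum X) x (vzero (c0_sum X)) = x"
      "vscale (c0_sum X) (c + d) x = vadd (c0_sum X) (vscale (c0_sum X) c x) (vscale (c0_sum X) d x)"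
      "vscale (c0_sum X) c (vscale (c0_sum X) d x) = vscale (c0_sum X) (c * d) x"
      "vscale (c0_sum X) 1 x = x"
      by (auto simp: fun_eq_iff app S.add_zero S.scale_add_left S.scale_scale S.scale_one mx)
    show "0 \<le> vnorm (c0_sum X) x" by (rule nn[OF x])
    show "vnorm (c0_sum X) x = 0 \<longleftrightarrow> x = vzero (c0_sum X)"
    proof
      assume "vnorm (c0_sum X) x = 0"
      then have "vnorm (X n) (x n) = 0" for n
        using c0_sum_norm_ge[OF x, of n] S.norm_nonneg[OF mx, of n] by simp
      then show "x = vzero (c0_sum X)"
        using S.norm_eq_zero[OF mx] by (auto simp: fun_eq_iff app)
    next
      assume e: "x = vzero (c0_sum X)"
      have "vnorm (c0_sum X) x \<le> 0"
        using S.norm_eq_zero[OF S.zero_closed] by (auto intro!: c0_sum_norm_le simp: e app)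
      with nn[OF x] show "vnorm (c0_sum X) x = 0" by simp
    qed
    show "vnorm (c0_sum X) (vscale (c0_sum X) c x) = \<bar>c\<bar> * vnorm (c0_sum X) x"
    proof (cases "c = 0")
      case True
      then show ?thesis using ns[OF x, of 0] nn[OF sc[OF x, of 0]] by simp
    next
      case False
      have "vscale (c0_sum X) (inverse c) (vscale (c0_sum X) c x) = x"
        using False by (auto simp: fun_eq_iff app S.scale_scale S.scale_one mx)
      then have "vnorm (c0_sum X) x \<le> \<bar>inverse c\<bar> * vnorm (c0_sum X) (vscale (c0_sum X) c x)"
        using ns[OF sc[OF x, of c], of "inverse c"] by simp
      then have "\<bar>c\<bar> * vnorm (c0_sum X) x \<le> vnorm (c0_sum X) (vscale (c0_sum X) c x)"
        using False by (simp add: field_simps)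
      with ns[OF x, of c] show ?thesis by simp
    qed
    assume y: "y \<in> vecs (c0_sum X)"
    note my = mem[OF y]
    show "vadd (c0_sum X) x y = vadd (c0_sum X) y x"
      by (auto simp: fun_eq_iff app S.add_commute mx my)
    show "vscale (c0_sum X) c (vadd (c0_sum X) x y)
        = vadd (c0_sum X) (vscale (c0_sum X) c x) (vscale (c0_sum X) c y)"
      by (auto simp: fun_eq_iff app S.scale_add_right mx my)
    show "vnorm (c0_sum X) (vadd (c0_sum X) x y) \<le> vnorm (c0_sum X) x + vnorm (c0_sum X) y"
    proof (rule c0_sum_norm_le)
      show "vnorm (X n) (vadd (c0_sum X) x y n) \<le> vnorm (c0_sum X) x + vnorm (c0_sum X) y" for n
        using S.norm_triangle[OF mx my, of n] c0_sum_norm_ge[OF x, of n] c0_sum_norm_ge[OF y, of n]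
        by (simp add: app)
    qed
    assume z: "z \<in> vecs (c0_sum X)"
    show "vadd (c0_sum X) (vadd (c0_sum X) x y) z = vadd (c0_sum X) x (vadd (c0_sum X) y z)"
      using mem[OF z] by (auto simp: fun_eq_iff app S.add_assoc mx my)
  qed (use add sc ze in auto)
qed

theorem banach_nspace_c0_sum:
  assumes "\<And>n. banach_nspace (X n)"
  shows "banach_nspace (c0_sum X)"
proof -
  interpret S: banach_nspace "X n" for n by (rule assms)
  interpret C: real_nspace "c0_sum X" by (intro real_nspace_c0_sum S.real_nspace_axioms)
  interpret CM: Metric_space "vecs (c0_sum X)" "vdist (c0_sum X)" by (rule C.metric)
  interpret SM: Metric_space "vecs (X n)" "vdist (X n)" for n by (rule S.metric)
  have mem: "x n \<in> vecs (X n)" if "x \<in> vecs (c0_sum X)" for x n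
    using that by (simp add: c0_sum_def)
  have diff: "vadd (c0_sum X) x (vscale (c0_sum X) (- 1) y) n
      = vadd (X n) (x n) (vscale (X n) (- 1) (y n))" for x y n
    by (simp add: c0_sum_def)
  have dist_ge: "vdist (X n) (x n) (y n) \<le> vdist (c0_sum X) x y"
    if "x \<in> vecs (c0_sum X)" "y \<in> vecs (c0_sum X)" for x y n
    using c0_sum_norm_ge[OF C.add_closed[OF that(1) C.scale_closed[OF that(2), of "- 1"]], of n] that
    by (simp add: vdist_def mem diff)
  have dist_le: "vdist (c0_sum X) x y \<le> r"
    if "x \<in> vecs (c0_sum X)" "y \<in> vecs (c0_sum X)" "\<And>n. vdist (X n) (x n) (y n) \<le> r" for x y r
    using that c0_sum_norm_le[of X "vadd (c0_sum X) x (vscale (c0_sum X) (- 1) y)" r]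
    by (simp add: vdist_def mem diff)
  have norm_dist: "vnorm (X n) u \<le> vnorm (X n) v + vdist (X n) u v"
    if "u \<in> vecs (X n)" "v \<in> vecs (X n)" for u v n
  proof -
    have "vadd (X n) (vadd (X n) u (vscale (X n) (- 1) v)) v
        = vadd (X n) u (vadd (X n) v (vscale (X n) (- 1) v))"
      using that by (simp add: S.add_assoc S.scale_closed S.add_commute)
    also have "\<dots> = u" using that by (simp add: S.add_minus S.add_zero)
    finally have "vadd (X n) (vadd (X n) u (vscale (X n) (- 1) v)) v = u" .
    with S.norm_triangle[of "vadd (X n) u (vscale (X n) (- 1) v)" n v] that show ?thesis
      by (simp add: vdist_def S.add_closed S.scale_closed)
  qed
  have "CM.mcomplete"
    unfolding CM.mcomplete_def
  proof (intro allI impI)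
    fix s assume s: "CM.MCauchy s"
    then have sC: "s k \<in> vecs (c0_sum X)" for k by (auto simp: CM.MCauchy_def)
    have cau: "\<exists>N. \<forall>i j. N \<le> i \<longrightarrow> N \<le> j \<longrightarrow> vdist (c0_sum X) (s i) (s j) < e" if "e > 0" for e
      using s that by (auto simp: CM.MCauchy_def)
    have "\<exists>l. limitin (SM.mtopology n) (\<lambda>k. s k n) l sequentially" for n
    proof -
      have "SM.MCauchy n (\<lambda>k. s k n)"
        unfolding SM.MCauchy_def
      proof (intro conjI allI impI)
        show "range (\<lambda>k. s k n) \<subseteq> vecs (X n)" using mem sC by auto
        fix e :: real assume "e > 0"
        from cau[OF this] obtain N where
          N: "\<And>i j. N \<le> i \<Longrightarrow> N \<le> j \<Longrightarrow> vdist (c0_sum X) (s i) (s j) < e" by blast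
        show "\<exists>N. \<forall>i j. N \<le> i \<longrightarrow> N \<le> j \<longrightarrow> vdist (X n) (s i n) (s j n) < e"
          using N dist_ge[OF sC sC] by (meson le_less_trans)
      qed
      then show ?thesis using S.complete[of n] unfolding SM.mcomplete_def by blast
    qed
    then obtain l where l: "\<And>n. limitin (SM.mtopology n) (\<lambda>k. s k n) (l n) sequentially" by metis
    have lmem: "l n \<in> vecs (X n)" for n using l[of n] by (simp add: SM.limitin_metric)
    have unif: "\<exists>N. \<forall>k\<ge>N. \<forall>n. vdist (X n) (s k n) (l n) \<le> e" if e: "e > 0" for e
    proof -
      from cau[OF e] obtain N where
        N: "\<And>i j. N \<le> i \<Longrightarrow> N \<le> j \<Longrightarrow> vdist (c0_sum X) (s i) (s j) < e" by blast
      have "vdist (X n) (s k n) (l n) \<le> e" if k: "k \<ge> N" for k n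
      proof (rule field_le_epsilon)
        fix d :: real assume "d > 0"
        then have "\<forall>\<^sub>F j in sequentially. s j n \<in> vecs (X n) \<and> vdist (X n) (s j n) (l n) < d"
          using l[of n] by (simp add: SM.limitin_metric)
        then obtain j0 where "\<And>j. j \<ge> j0 \<Longrightarrow> vdist (X n) (s j n) (l n) < d"
          unfolding eventually_sequentially by blast
        then have j: "vdist (X n) (s (max j0 N) n) (l n) < d" by simp
        have "vdist (X n) (s k n) (l n)
            \<le> vdist (X n) (s k n) (s (max j0 N) n) + vdist (X n) (s (max j0 N) n) (l n)"
          by (rule SM.triangle) (auto simp: lmem mem sC)
        also have "vdist (X n) (s k n) (s (max j0 N) n) < e"
          using le_less_trans[OF dist_ge[OF sC sC] N] k by simp
        finally show "vdist (X n) (s k n) (l n) \<le> e + d" using j by simp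
      qed
      then show ?thesis by blast
    qed
    have lC: "l \<in> vecs (c0_sum X)"
    proof -
      have "(\<lambda>n. vnorm (X n) (l n)) \<longlonglongrightarrow> 0"
      proof (rule LIMSEQ_I)
        fix e :: real assume e: "e > 0"
        then obtain k where k: "\<And>n. vdist (X n) (s k n) (l n) \<le> e / 2"
          using unif[of "e / 2"] by auto
        have "(\<lambda>n. vnorm (X n) (s k n)) \<longlonglongrightarrow> 0" using sC[of k] by (simp add: c0_sum_def)
        from LIMSEQ_D[OF this, of "e / 2"] e obtain n0 where
          n0: "\<And>n. n \<ge> n0 \<Longrightarrow> \<bar>vnorm (X n) (s k n)\<bar> < e / 2" by auto
        have "norm (vnorm (X n) (l n) - 0) < e" if "n \<ge> n0" for n
          using norm_dist[OF lmem[of n] mem[OF sC[of k], of n]] k[of n] n0[OF that]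
            S.norm_nonneg[OF lmem[of n]] SM.commute[of n "l n" "s k n"] by simp
        then show "\<exists>n0. \<forall>n\<ge>n0. norm (vnorm (X n) (l n) - 0) < e" by blast
      qed
      then show ?thesis using lmem by (simp add: c0_sum_def)
    qed
    have "limitin CM.mtopology s l sequentially"
      unfolding CM.limitin_metric eventually_sequentially
    proof (intro conjI lC allI impI)
      fix e :: real assume e: "e > 0"
      then obtain N where N: "\<And>k n. k \<ge> N \<Longrightarrow> vdist (X n) (s k n) (l n) \<le> e / 2"
        using unif[of "e / 2"] by auto
      have "vdist (c0_sum X) (s k) l < e" if "k \<ge> N" for k
        using dist_le[OF sC lC N[OF that]] e by simp
      then show "\<exists>N. \<forall>k\<ge>N. s k \<in> vecs (c0_sum X) \<and> vdist (c0_sum X) (s k) l < e"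
        using sC by blast
    qed
    then show "\<exists>l. limitin CM.mtopology s l sequentially" by blast
  qed
  then show ?thesis by unfold_locales
qed

end

(*
The dual of the c_0-sum is the l_1-sum of the duals, so the distance between two functionals is the
sum of the distances of their coordinates. Call the length of a path in the dual ball of X_n the
sum of its step lengths. If X_n has summable Szlenk index with constant M, then M times
the norm of the endpoint bounds the length of a path whose steps are chosen in sufficiently small
weak* neighbourhoods, because the derivations are homogeneous. Since the norm is
weak* lower semicontinuous, with M + 1 in place of M one can even pay for the norm of the starting
point. This gives a strategy for choosing neighbourhoods in each coordinate,
started when that coordinate becomes relevant, and the strategies combine: a path in the ball of
the l_1-sum has length at most M + 1 times the norm of its endpoint, up to a small error. A point of
an e-derivation has points of the underlying set at distance more than e/2 in each of its
neighbourhoods, hence e_1 + ... + e_n is at most 2 (M + 1).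
*)
theory Submission
  imports Defs
begin

section \<open>Bounded functionals\<close>

text \<open>The condition of \<open>dual\<close> without extensionality, because the differences
  inside \<open>dual_diam\<close> need not be extensional.\<close>

definition bounded_functional :: "'a nspace \<Rightarrow> ('a \<Rightarrow> real) \<Rightarrow> bool" where
  "bounded_functional X h \<longleftrightarrow>
     (\<forall>x\<in>vecs X. \<forall>y\<in>vecs X. h (vadd X x y) = h x + h y) \<and>
     (\<forall>x\<in>vecs X. \<forall>c. h (vscale X c x) = c * h x) \<and>
     (\<exists>C. \<forall>x\<in>vecs X. \<bar>h x\<bar> \<le> C * vnorm X x)"

lemma mem_dual_iff: "f \<in> dual X \<longleftrightarrow> f \<in> extensional (vecs X) \<and> bounded_functional X f"
  by (auto simp: dual_def bounded_functional_def)

lemma dual_bounded_functional: "f \<in> dual X \<Longrightarrow> bounded_functional X f"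
  by (simp add: mem_dual_iff)

lemma dual_ball_subset: "dual_ball X \<subseteq> dual X"
  by (auto simp: dual_ball_def)

lemma bounded_functional_diff:
  assumes "bounded_functional X f" "bounded_functional X g"
  shows "bounded_functional X (\<lambda>x. f x - g x)"
proof -
  obtain C D where C: "\<forall>x\<in>vecs X. \<bar>f x\<bar> \<le> C * vnorm X x" and D: "\<forall>x\<in>vecs X. \<bar>g x\<bar> \<le> D * vnorm X x"
    using assms unfolding bounded_functional_def by blast
  have "\<bar>f x - g x\<bar> \<le> (C + D) * vnorm X x" if "x \<in> vecs X" for x
    using C[rule_format, OF that] D[rule_format, OF that] by (simp add: distrib_right)
  then have "\<exists>C. \<forall>x\<in>vecs X. \<bar>f x - g x\<bar> \<le> C * vnorm X x" by blast
  then show ?thesis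
    using assms unfolding bounded_functional_def by (simp add: right_diff_distrib)
qed

lemma bounded_functional_scale:
  assumes "bounded_functional X f"
  shows "bounded_functional X (\<lambda>x. r * f x)"
proof -
  obtain C where C: "\<forall>x\<in>vecs X. \<bar>f x\<bar> \<le> C * vnorm X x"
    using assms unfolding bounded_functional_def by blast
  have "\<bar>r * f x\<bar> \<le> (\<bar>r\<bar> * C) * vnorm X x" if "x \<in> vecs X" for x
    using mult_left_mono[OF C[rule_format, OF that], of "\<bar>r\<bar>"] by (simp add: abs_mult mult.assoc)
  then have "\<exists>C. \<forall>x\<in>vecs X. \<bar>r * f x\<bar> \<le> C * vnorm X x" by blast
  then show ?thesis
    using assms unfolding bounded_functional_def by (simp add: distrib_left)
qed

lemma dual_norm_cong: "(\<And>x. x \<in> vecs X \<Longrightarrow> f x = g x) \<Longrightarrow> dual_norm X f = dual_norm X g"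
  unfolding dual_norm_def by (intro SUP_cong) auto

context real_nspace
begin

lemma bounded_functional_restrict:
  "bounded_functional X h \<Longrightarrow> bounded_functional X (restrict h (vecs X))"
  unfolding bounded_functional_def by (simp add: add_closed scale_closed)

lemma vnorm_zero: "vnorm X (vzero X) = 0"
  using norm_eq_zero[OF zero_closed] by simp

lemma bounded_functional_zero: "bounded_functional X h \<Longrightarrow> h (vzero X) = 0"
  using scale_zero_left[OF zero_closed] zero_closed unfolding bounded_functional_def
  by (metis mult_zero_left)

lemma dual_norm_upper:
  assumes h: "bounded_functional X h" and x: "x \<in> vecs X" "vnorm X x \<le> 1"
  shows "\<bar>h x\<bar> \<le> dual_norm X h"
proof -
  obtain C where C: "\<forall>x\<in>vecs X. \<bar>h x\<bar> \<le> C * vnorm X x"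
    using h unfolding bounded_functional_def by blast
  have "\<bar>h y\<bar> \<le> \<bar>C\<bar>" if "y \<in> vecs X" "vnorm X y \<le> 1" for y
  proof -
    have "C * vnorm X y \<le> \<bar>C\<bar> * vnorm X y"
      by (intro mult_right_mono norm_nonneg that) auto
    also have "\<dots> \<le> \<bar>C\<bar> * 1" using that by (intro mult_left_mono) auto
    finally show ?thesis using C that(1) by force
  qed
  then have "bdd_above ((\<lambda>x. \<bar>h x\<bar>) ` {x \<in> vecs X. vnorm X x \<le> 1})"
    by (auto intro!: bdd_aboveI[of _ "\<bar>C\<bar>"])
  then show ?thesis unfolding dual_norm_def by (rule cSUP_upper[rotated]) (use x in auto)
qed

lemma dual_norm_least:
  assumes "\<And>x. x \<in> vecs X \<Longrightarrow> vnorm X x \<le> 1 \<Longrightarrow> \<bar>h x\<bar> \<le> c"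
  shows "dual_norm X h \<le> c"
  unfolding dual_norm_def
  by (rule cSUP_least) (use assms zero_closed vnorm_zero in \<open>auto intro!: exI[of _ "vzero X"]\<close>)

lemma dual_norm_witness:
  assumes "c < dual_norm X h"
  obtains x where "x \<in> vecs X" "vnorm X x \<le> 1" "c < \<bar>h x\<bar>"
  using assms dual_norm_least[of h c] by (meson not_le)

lemma dual_norm_nonneg: "bounded_functional X h \<Longrightarrow> 0 \<le> dual_norm X h"
  using dual_norm_upper[of h "vzero X"] zero_closed vnorm_zero by force

lemma dual_norm_bound:
  assumes h: "bounded_functional X h" and x: "x \<in> vecs X"
  shows "\<bar>h x\<bar> \<le> dual_norm X h * vnorm X x"
proof (cases "vnorm X x = 0")
  case True
  then have "x = vzero X" using x norm_eq_zero by simp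
  then show ?thesis using bounded_functional_zero[OF h] True by simp
next
  case False
  let ?n = "vnorm X x"
  have p: "?n > 0" using False norm_nonneg[OF x] by simp
  have "\<bar>h (vscale X (1 / ?n) x)\<bar> \<le> dual_norm X h"
    by (rule dual_norm_upper[OF h scale_closed[OF x]]) (use p in \<open>simp add: norm_scale x\<close>)
  moreover have "h (vscale X (1 / ?n) x) = h x / ?n"
    using h x unfolding bounded_functional_def by simp
  ultimately show ?thesis using p by (simp add: field_simps)
qed

lemma dual_norm_diff_commute:
  "dual_norm X (\<lambda>x. f x - g x) = dual_norm X (\<lambda>x. g x - f x)"
  unfolding dual_norm_def by (simp add: abs_minus_commute)

lemma dual_norm_diff_triangle:
  assumes "bounded_functional X f" "bounded_functional X g" "bounded_functional X k"
  shows "dual_norm X (\<lambda>x. f x - g x)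
    \<le> dual_norm X (\<lambda>x. f x - k x) + dual_norm X (\<lambda>x. k x - g x)"
proof (rule dual_norm_least)
  fix x assume x: "x \<in> vecs X" "vnorm X x \<le> 1"
  show "\<bar>f x - g x\<bar> \<le> dual_norm X (\<lambda>x. f x - k x) + dual_norm X (\<lambda>x. k x - g x)"
    using dual_norm_upper[OF bounded_functional_diff[OF assms(1,3)] x]
      dual_norm_upper[OF bounded_functional_diff[OF assms(3,2)] x] by simp
qed

lemma dual_norm_diff_le:
  assumes "bounded_functional X f" "bounded_functional X g"
  shows "dual_norm X (\<lambda>x. f x - g x) \<le> dual_norm X g + dual_norm X f"
proof (rule dual_norm_least)
  fix x assume x: "x \<in> vecs X" "vnorm X x \<le> 1"
  show "\<bar>f x - g x\<bar> \<le> dual_norm X g + dual_norm X f"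
    using dual_norm_upper[OF assms(1) x] dual_norm_upper[OF assms(2) x] by simp
qed

end


section \<open>Szlenk derivations\<close>

lemma topspace_weak_star: "topspace (weak_star X) = dual X"
  by (auto simp: weak_star_def dual_def PiE_def)

lemma continuous_map_weak_star_eval:
  "x \<in> vecs X \<Longrightarrow> continuous_map (weak_star X) euclideanreal (\<lambda>f. f x)"
  unfolding weak_star_def
  by (intro continuous_map_from_subtopology continuous_map_product_projection)

lemma continuous_map_into_weak_star:
  assumes "\<And>f. f \<in> topspace T \<Longrightarrow> F f \<in> dual X"
    and "\<And>x. x \<in> vecs X \<Longrightarrow> continuous_map T euclideanreal (\<lambda>f. F f x)"
  shows "continuous_map T (weak_star X) F"
  unfolding weak_star_def continuous_map_in_subtopology continuous_map_componentwise
  using assms by (auto simp: dual_def)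

text \<open>A supremum exceeds \<open>e\<close> exactly when some member does; with
  \<open>0 \<le> e\<close> the embedding into \<open>ennreal\<close> reflects the strict
  inequality.\<close>

lemma mem_szlenk_iff:
  assumes "0 \<le> e"
  shows "f \<in> szlenk X e K \<longleftrightarrow> f \<in> K \<and> (\<forall>U. openin (weak_star X) U \<and> f \<in> U \<longrightarrow>
    (\<exists>g\<in>K \<inter> U. \<exists>h\<in>K \<inter> U. e < dual_norm X (\<lambda>x. g x - h x)))"
  unfolding szlenk_def dual_diam_def using assms by (simp add: less_SUP_iff ennreal_less_iff)

lemma szlenk_subset: "szlenk X e K \<subseteq> K"
  by (auto simp: szlenk_def)

lemma foldr_szlenk_subset: "foldr (szlenk X) es K \<subseteq> K"
  by (induction es) (use szlenk_subset in fastforce)+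

text \<open>Of two points more than \<open>e\<close> apart, one is more than \<open>e / 2\<close>
  from \<open>f\<close>. A path can thus move on from \<open>f\<close> itself, at the price of the
  factor 2 in the final bound.\<close>

lemma (in real_nspace) szlenk_half:
  assumes e: "0 \<le> e" and f: "f \<in> szlenk X e K" and K: "K \<subseteq> dual X"
    and U: "openin (weak_star X) U" "f \<in> U"
  obtains g where "g \<in> K" "g \<in> U" "e / 2 < dual_norm X (\<lambda>x. f x - g x)"
proof -
  obtain g h where gh: "g \<in> K \<inter> U" "h \<in> K \<inter> U" "e < dual_norm X (\<lambda>x. g x - h x)"
    using f U unfolding mem_szlenk_iff[OF e] by blast
  have "f \<in> K" using f szlenk_subset by blast
  then have "dual_norm X (\<lambda>x. g x - h x)
      \<le> dual_norm X (\<lambda>x. f x - g x) + dual_norm X (\<lambda>x. f x - h x)"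
    using dual_norm_diff_triangle[of g h f] dual_norm_diff_commute[of f g] gh K
    by (auto simp: dual_bounded_functional subset_iff)
  then have "e / 2 < dual_norm X (\<lambda>x. f x - g x) \<or> e / 2 < dual_norm X (\<lambda>x. f x - h x)"
    using gh(3) by linarith
  then show thesis using that gh by blast
qed

section \<open>Weak* closed sets and homogeneity of the derivations\<close>

definition dual_cball :: "'a nspace \<Rightarrow> real \<Rightarrow> ('a \<Rightarrow> real) set" where
  "dual_cball X r = {f \<in> dual X. dual_norm X f \<le> r}"

text \<open>Weak* lower semicontinuity of the norm: the ball is cut out by the closed conditions
  \<open>\<bar>f x\<bar> \<le> r\<close>, one for each \<open>x\<close> in the unit ball.\<close>

lemma (in real_nspace) closedin_dual_cball: "closedin (weak_star X) (dual_cball X r)"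
proof -
  have "dual_cball X r =
      {f \<in> dual X. \<forall>x\<in>{x \<in> vecs X. vnorm X x \<le> 1}. \<bar>f x\<bar> \<le> r}"
    unfolding dual_cball_def
    by (auto intro: dual_norm_least order_trans[OF dual_norm_upper] dual_bounded_functional)
  also have "\<dots> = topspace (weak_star X) \<inter>
      (\<Inter>x\<in>{x \<in> vecs X. vnorm X x \<le> 1}. {f \<in> topspace (weak_star X). f x \<in> {- r..r}})"
    unfolding topspace_weak_star by (auto simp: abs_le_iff minus_le_iff)
  also have "closedin (weak_star X) \<dots>"
  proof (rule closedin_Int[OF closedin_topspace], rule closedin_INT)
    show "{x \<in> vecs X. vnorm X x \<le> 1} \<noteq> {}" using zero_closed vnorm_zero by force
    show "closedin (weak_star X) {f \<in> topspace (weak_star X). f x \<in> {- r..r}}"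
      if "x \<in> {x \<in> vecs X. vnorm X x \<le> 1}" for x
      by (rule closedin_continuous_map_preimage[OF continuous_map_weak_star_eval]) (use that in auto)
  qed
  finally show ?thesis .
qed

lemma closedin_szlenk:
  assumes "closedin (weak_star X) K"
  shows "closedin (weak_star X) (szlenk X e K)"
proof -
  have "szlenk X e K = K - \<Union>{U. openin (weak_star X) U \<and> \<not> dual_diam X (K \<inter> U) > ennreal e}"
    unfolding szlenk_def by blast
  then show ?thesis using assms by (auto intro!: closedin_diff openin_Union)
qed

lemma closedin_foldr_szlenk:
  "closedin (weak_star X) K \<Longrightarrow> closedin (weak_star X) (foldr (szlenk X) es K)"
  by (induction es) (auto intro: closedin_szlenk)

text \<open>Multiplication by \<open>r\<close> is weak* continuous and multiplies distances by
  \<open>r\<close>, so a pair near \<open>f\<close> yields one near \<open>S f\<close>. Allowing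
  \<open>L\<close> to exceed the image of \<open>K\<close> makes the lemma iterable.\<close>

lemma (in real_nspace) szlenk_scale:
  fixes r :: real
  defines "S \<equiv> \<lambda>f. restrict (\<lambda>x. r * f x) (vecs X)"
  assumes r: "0 < r" and e: "0 \<le> e" and K: "K \<subseteq> dual X" and L: "S ` K \<subseteq> L"
  shows "S ` szlenk X e K \<subseteq> szlenk X (r * e) L"
proof
  fix f' assume "f' \<in> S ` szlenk X e K"
  then obtain f where f: "f \<in> szlenk X e K" "f' = S f" by blast
  have S: "S h \<in> dual X" if "h \<in> dual X" for h
    using that unfolding mem_dual_iff S_def
    by (simp add: bounded_functional_restrict bounded_functional_scale)
  have cont: "continuous_map (weak_star X) (weak_star X) S"
  proof (rule continuous_map_into_weak_star)
    show "continuous_map (weak_star X) euclideanreal (\<lambda>f. S f x)" if "x \<in> vecs X" for x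
      using that unfolding S_def
      by (auto intro!: continuous_map_real_mult continuous_map_weak_star_eval)
  qed (simp add: S topspace_weak_star)
  have re: "0 \<le> r * e" using r e by simp
  show "f' \<in> szlenk X (r * e) L"
    unfolding mem_szlenk_iff[OF re]
  proof (intro conjI allI impI)
    show "f' \<in> L" using f szlenk_subset L by blast
    fix U assume U: "openin (weak_star X) U \<and> f' \<in> U"
    let ?V = "{h \<in> dual X. S h \<in> U}"
    have "openin (weak_star X) ?V"
      using openin_continuous_map_preimage[OF cont] U by (simp add: topspace_weak_star)
    moreover have "f \<in> ?V" using f U szlenk_subset K by blast
    ultimately obtain g h where gh: "g \<in> K \<inter> ?V" "h \<in> K \<inter> ?V" "e < dual_norm X (\<lambda>x. g x - h x)"
      using f(1) unfolding mem_szlenk_iff[OF e] by blast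
    from gh(3) obtain x where x: "x \<in> vecs X" "vnorm X x \<le> 1" "e < \<bar>g x - h x\<bar>"
      by (rule dual_norm_witness)
    have "r * e < r * \<bar>g x - h x\<bar>" using x r by simp
    also have "\<dots> = \<bar>S g x - S h x\<bar>"
      using x r by (simp add: S_def abs_mult flip: right_diff_distrib)
    also have "\<dots> \<le> dual_norm X (\<lambda>x. S g x - S h x)"
      by (rule dual_norm_upper[OF bounded_functional_diff])
         (use gh x S in \<open>auto intro: dual_bounded_functional\<close>)
    finally show "\<exists>g\<in>L \<inter> U. \<exists>h\<in>L \<inter> U. r * e < dual_norm X (\<lambda>x. g x - h x)"
      using gh L by blast
  qed
qed

lemma (in real_nspace) foldr_szlenk_scale:
  fixes r :: real
  defines "S \<equiv> \<lambda>f. restrict (\<lambda>x. r * f x) (vecs X)"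
  assumes "0 < r" "\<forall>e\<in>set es. 0 \<le> e" "K \<subseteq> dual X" "S ` K \<subseteq> L"
  shows "S ` foldr (szlenk X) es K \<subseteq> foldr (szlenk X) (map ((*) r) es) L"
  using assms(3)
proof (induction es)
  case Nil
  then show ?case using \<open>S ` K \<subseteq> L\<close> by (simp only: foldr.simps list.map id_apply)
next
  case (Cons e es)
  have sub: "foldr (szlenk X) es K \<subseteq> dual X"
    using foldr_szlenk_subset \<open>K \<subseteq> dual X\<close> by blast
  show ?case
    using szlenk_scale[OF \<open>0 < r\<close> _ sub, folded S_def, OF _ Cons.IH] Cons.prems by simp
qed

text \<open>Division by \<open>r\<close> maps the ball of radius \<open>r\<close> into the unit ball
  and divides the parameters by \<open>r\<close>. The empty list, left out by
  \<open>summable_szlenk_with\<close>, is covered by \<open>0 \<le> M\<close>.\<close>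

lemma (in real_nspace) sum_list_le_of_foldr_szlenk_cball:
  assumes M: "summable_szlenk_with M X" "0 \<le> M" and r: "0 < r"
    and es: "\<forall>e\<in>set es. 0 < e" and f: "f \<in> foldr (szlenk X) es (dual_cball X r)"
  shows "sum_list es \<le> r * M"
proof (cases "es = []")
  case False
  have "restrict (\<lambda>x. (1 / r) * f x) (vecs X) \<in> dual_ball X" if "f \<in> dual_cball X r" for f
  proof -
    have f: "f \<in> dual X" "dual_norm X f \<le> r" using that by (auto simp: dual_cball_def)
    have "\<bar>f x / r\<bar> \<le> 1" if "x \<in> vecs X" "vnorm X x \<le> 1" for x
      using dual_norm_upper[OF dual_bounded_functional[OF f(1)] that] f(2) r by simp
    then show ?thesis
      using f(1) bounded_functional_restrict[OF bounded_functional_scale[of X f "1 / r"]]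
      unfolding dual_ball_def mem_dual_iff by (auto intro!: dual_norm_least)
  qed
  then have "restrict (\<lambda>x. (1 / r) * f x) (vecs X)
      \<in> foldr (szlenk X) (map ((*) (1 / r)) es) (dual_ball X)"
    using foldr_szlenk_scale[of "1 / r" es "dual_cball X r" "dual_ball X"] f r es
    by (force simp: dual_cball_def)
  then have "sum_list (map ((*) (1 / r)) es) \<le> M"
    using M(1)[unfolded summable_szlenk_with_def, rule_format, of "map ((*) (1 / r)) es"] False es r
    by auto
  then have "(1 / r) * sum_list es \<le> M"
    using sum_list_const_mult[of "1 / r" "\<lambda>x. x" es] by simp
  then show ?thesis using r by (simp add: field_simps)
qed (use r M in simp)


section \<open>The approximation game in a dual ball\<close>

text \<open>Player W names weak* neighbourhoods and player V answers with points of the dual ball in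
  them. From the point \<open>f\<close>, W can keep the length of the path of V over \<open>n\<close> moves, minus \<open>C\<close> times
  the norm of its endpoint, at most \<open>s\<close>.\<close>

primrec controls :: "'a nspace \<Rightarrow> real \<Rightarrow> nat \<Rightarrow> ('a \<Rightarrow> real) \<Rightarrow> real \<Rightarrow> bool" where
  "controls X C 0 f s \<longleftrightarrow> - C * dual_norm X f \<le> s"
| "controls X C (Suc n) f s \<longleftrightarrow> (\<exists>U. openin (weak_star X) U \<and> f \<in> U \<and>
     (\<forall>g\<in>U \<inter> dual_ball X. controls X C n g (s - dual_norm X (\<lambda>x. f x - g x))))"

text \<open>If each pattern failed throughout some neighbourhood, no pattern would occur in the
  intersection of these finitely many neighbourhoods.\<close>

lemma finite_pattern_cofinal:
  assumes P: "finite P" and f: "f \<in> topspace T"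
    and ex: "\<And>U. openin T U \<Longrightarrow> f \<in> U \<Longrightarrow> \<exists>p\<in>P. \<exists>g\<in>U. Q p g"
  shows "\<exists>p\<in>P. \<forall>U. openin T U \<and> f \<in> U \<longrightarrow> (\<exists>g\<in>U. Q p g)"
proof (rule ccontr)
  assume "\<not> ?thesis"
  then have "\<forall>p\<in>P. \<exists>U. openin T U \<and> f \<in> U \<and> (\<forall>g\<in>U. \<not> Q p g)" by simp
  from bchoice[OF this] obtain U where
    U: "\<forall>p\<in>P. openin T (U p) \<and> f \<in> U p \<and> (\<forall>g\<in>U p. \<not> Q p g)" ..
  have "openin T (topspace T \<inter> \<Inter>(U ` P))"
    using P U by (cases "P = {}") (auto intro!: openin_Int openin_Inter)
  moreover have "f \<in> topspace T \<inter> \<Inter>(U ` P)" using U f by simp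
  ultimately have "\<exists>p\<in>P. \<exists>g\<in>topspace T \<inter> \<Inter>(U ` P). Q p g" by (rule ex)
  then show False using U by auto
qed

text \<open>A step rounded to length 0 triggers no derivation, as summability only speaks of
  positive parameters.\<close>

lemma foldr_szlenk_nonzero:
  "foldr (\<lambda>a K. if a = 0 then K else szlenk X a K) as K = foldr (szlenk X) (filter (\<lambda>a. a \<noteq> 0) as) K"
  by (induction as) auto

section \<open>Rounding lengths and norms to a finite grid\<close>

definition grid :: "real \<Rightarrow> real \<Rightarrow> real set" where
  "grid \<eta> b = (\<lambda>k. real k * \<eta>) ` {k. real k * \<eta> \<le> b}"

lemma finite_grid: "0 < \<eta> \<Longrightarrow> finite (grid \<eta> b)"
proof -
  assume "0 < \<eta>"
  then have "{k. real k * \<eta> \<le> b} \<subseteq> {..nat \<lceil>b / \<eta>\<rceil>}"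
    by (auto simp: pos_le_divide_eq[symmetric] le_nat_iff) linarith
  then show ?thesis unfolding grid_def using finite_subset by blast
qed

lemma grid_nonneg: "0 < \<eta> \<Longrightarrow> a \<in> grid \<eta> b \<Longrightarrow> 0 \<le> a"
  by (auto simp: grid_def)

text \<open>For the norm of the endpoint. The result is positive even when \<open>t = 0\<close>,
  since it serves as the radius of a ball to be rescaled.\<close>

lemma grid_above:
  assumes "0 < \<eta>" "0 \<le> t" "t \<le> b"
  obtains a where "a \<in> grid \<eta> (b + \<eta>)" "0 < a" "t \<le> a" "a \<le> t + \<eta>"
proof -
  define k where "k = nat \<lfloor>t / \<eta>\<rfloor> + 1"
  have "real k = of_int \<lfloor>t / \<eta>\<rfloor> + 1" using assms by (simp add: k_def)
  then have "t / \<eta> \<le> real k" "real k \<le> t / \<eta> + 1" by linarith+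
  then have "t \<le> real k * \<eta>" "real k * \<eta> \<le> t + \<eta>" using assms by (auto simp: field_simps)
  moreover have "0 < real k * \<eta>"
    unfolding k_def using \<open>0 < \<eta>\<close> by (intro mult_pos_pos) simp_all
  ultimately show thesis using that[of "real k * \<eta>"] assms by (auto simp: grid_def)
qed

text \<open>For step lengths. A nonzero result lies strictly below \<open>t\<close>, as the strict
  inequality in the derivation demands.\<close>

lemma grid_below:
  assumes "0 < \<eta>" "0 \<le> t" "t \<le> b"
  obtains a where "a \<in> grid \<eta> b" "a \<noteq> 0 \<Longrightarrow> a < t" "t \<le> a + \<eta>"
proof (cases "t = 0")
  case True
  then show ?thesis using that[of 0] assms by (auto simp: grid_def intro!: image_eqI[of _ _ 0])
next
  case False
  \<comment> \<open>The ceiling minus one, unlike the floor, stays strictly below when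
    \<open>t\<close> is itself a grid point.\<close>
  define k where "k = nat (\<lceil>t / \<eta>\<rceil> - 1)"
  have "0 < t / \<eta>" using assms False by simp
  then have "real k = of_int \<lceil>t / \<eta>\<rceil> - 1" by (simp add: k_def)
  then have "real k < t / \<eta>" "t / \<eta> \<le> real k + 1" by linarith+
  then have "real k * \<eta> < t" "t \<le> real k * \<eta> + \<eta>" using assms by (auto simp: field_simps)
  then show thesis using that[of "real k * \<eta>"] assms by (auto simp: grid_def)
qed

text \<open>V, who wins, can be made to move by lengths rounded to a finite grid and fixed in advance:
  finitely many patterns of lengths are possible, and one of them occurs in arbitrarily small
  neighbourhoods. The norm \<open>r\<close> of the endpoint is also fixed, so that the ball can be rescaled.\<close>

lemma (in real_nspace) not_controls_pattern:
  assumes \<eta>: "0 < \<eta>" and C: "0 \<le> C" and f: "f \<in> dual_ball X"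
    and nc: "\<not> controls X C n f s"
  obtains as r where "length as = n" "set as \<subseteq> grid \<eta> 2" "r \<in> grid \<eta> (1 + \<eta>)" "0 < r"
    "f \<in> foldr (\<lambda>a K. if a = 0 then K else szlenk X a K) as (dual_cball X r)"
    "s \<le> sum_list as + n * \<eta> - C * (r - \<eta>)"
proof -
  let ?D = "\<lambda>as. foldr (\<lambda>a K. if a = 0 then K else szlenk X a K) as"
  let ?Q = "\<lambda>n s as r. length as = n \<and> set as \<subseteq> grid \<eta> 2 \<and> r \<in> grid \<eta> (1 + \<eta>) \<and> 0 < r \<and>
      s \<le> sum_list as + real n * \<eta> - C * (r - \<eta>)"
  have "\<exists>as r. ?Q n s as r \<and> f \<in> ?D as (dual_cball X r)"
    using f nc
  proof (induction n arbitrary: f s)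
    case 0
    have fd: "f \<in> dual X" "dual_norm X f \<le> 1" using 0 by (auto simp: dual_ball_def)
    obtain r where r: "r \<in> grid \<eta> (1 + \<eta>)" "0 < r" "dual_norm X f \<le> r" "r \<le> dual_norm X f + \<eta>"
      using grid_above[OF \<eta> dual_norm_nonneg fd(2)] fd by (auto simp: dual_bounded_functional)
    have "C * (r - \<eta>) \<le> C * dual_norm X f" using r C by (intro mult_left_mono) auto
    then show ?case using r 0 fd by (intro exI[of _ "[]"] exI[of _ r]) (auto simp: dual_cball_def)
  next
    case (Suc n)
    have fd: "f \<in> dual X" "dual_norm X f \<le> 1" using Suc.prems by (auto simp: dual_ball_def)
    \<comment> \<open>A pattern consists of the first step length, the later ones and the
      radius.\<close>
    define P where "P = grid \<eta> 2 \<times> {as. set as \<subseteq> grid \<eta> 2 \<and> length as = n} \<times> grid \<eta> (1 + \<eta>)"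
    define R where "R = (\<lambda>p g. case p of (a, as, r) \<Rightarrow>
        ?Q (Suc n) s (a # as) r \<and> g \<in> ?D as (dual_cball X r)
        \<and> (a \<noteq> 0 \<longrightarrow> a < dual_norm X (\<lambda>x. f x - g x)))"
    have "\<exists>p\<in>P. \<forall>U. openin (weak_star X) U \<and> f \<in> U \<longrightarrow> (\<exists>g\<in>U. R p g)"
    proof (rule finite_pattern_cofinal)
      show "finite P"
        unfolding P_def by (intro finite_cartesian_product finite_lists_length_eq finite_grid \<eta>)
      show "f \<in> topspace (weak_star X)" using fd by (simp add: topspace_weak_star)
      fix U assume U: "openin (weak_star X) U" "f \<in> U"
      then obtain g where g: "g \<in> U" "g \<in> dual_ball X"
        "\<not> controls X C n g (s - dual_norm X (\<lambda>x. f x - g x))"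
        using Suc.prems by auto
      from Suc.IH[OF g(2,3)] obtain as r where
        p: "?Q n (s - dual_norm X (\<lambda>x. f x - g x)) as r" "g \<in> ?D as (dual_cball X r)" by blast
      have gd: "g \<in> dual X" "dual_norm X g \<le> 1" using g by (auto simp: dual_ball_def)
      have "dual_norm X (\<lambda>x. f x - g x) \<le> 2"
      proof (rule dual_norm_least)
        fix x assume "x \<in> vecs X" "vnorm X x \<le> 1"
        then show "\<bar>f x - g x\<bar> \<le> 2"
          using dual_norm_upper[of f x] dual_norm_upper[of g x] fd gd
          by (simp add: dual_bounded_functional)
      qed
      moreover have "0 \<le> dual_norm X (\<lambda>x. f x - g x)"
        using fd gd by (intro dual_norm_nonneg bounded_functional_diff dual_bounded_functional)
      ultimately obtain a where a: "a \<in> grid \<eta> 2" "a \<noteq> 0 \<Longrightarrow> a < dual_norm X (\<lambda>x. f x - g x)"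
          "dual_norm X (\<lambda>x. f x - g x) \<le> a + \<eta>"
        using grid_below[OF \<eta>] by blast
      have "R (a, as, r) g"
        using p a unfolding R_def by (simp add: algebra_simps)
      moreover have "(a, as, r) \<in> P" using p a unfolding P_def by simp
      ultimately show "\<exists>p\<in>P. \<exists>g\<in>U. R p g" using g(1) by blast
    qed
    then obtain q where q: "q \<in> P"
      "\<forall>U. openin (weak_star X) U \<and> f \<in> U \<longrightarrow> (\<exists>g\<in>U. R q g)" ..
    obtain a as r where "q = (a, as, r)" by (rule prod_cases3)
    with q have p: "a \<in> grid \<eta> 2"
      "\<And>U. openin (weak_star X) U \<Longrightarrow> f \<in> U \<Longrightarrow> \<exists>g\<in>U. R (a, as, r) g"
      by (simp_all add: P_def)
    \<comment> \<open>The numerical conditions do not involve the answer of V, so one instance in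
      the whole dual provides them.\<close>
    from p(2)[of "dual X"] obtain g0 where "R (a, as, r) g0"
      using fd openin_topspace[of "weak_star X"] by (auto simp: topspace_weak_star)
    then have Q: "?Q (Suc n) s (a # as) r" by (simp add: R_def)
    let ?K = "?D as (dual_cball X r)"
    have K: "closedin (weak_star X) ?K"
      unfolding foldr_szlenk_nonzero by (intro closedin_foldr_szlenk closedin_dual_cball)
    \<comment> \<open>Points of \<open>?K\<close> occur in every neighbourhood of \<open>f\<close>,
      and \<open>?K\<close> is weak* closed.\<close>
    have fK: "f \<in> ?K"
    proof (rule ccontr)
      assume "f \<notin> ?K"
      then show False
        using p(2)[OF openin_diff[OF openin_topspace K]] fd by (auto simp: topspace_weak_star R_def)
    qed
    have "f \<in> szlenk X a ?K" if "a \<noteq> 0"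
      unfolding mem_szlenk_iff[OF grid_nonneg[OF \<eta> p(1)]]
    proof (intro conjI allI impI fK)
      fix U assume U: "openin (weak_star X) U \<and> f \<in> U"
      then obtain g where g: "g \<in> U" "R (a, as, r) g" using p(2)[of U] by blast
      then have "g \<in> ?K" "a < dual_norm X (\<lambda>x. f x - g x)" using that by (simp_all add: R_def)
      then show "\<exists>g\<in>?K \<inter> U. \<exists>h\<in>?K \<inter> U. a < dual_norm X (\<lambda>x. g x - h x)"
        using fK U g(1) by (intro bexI[of _ f] bexI[of _ g] IntI) simp_all
    qed
    then have "f \<in> ?D (a # as) (dual_cball X r)" using fK by simp
    with Q show ?case by blast
  qed
  then show thesis by (elim exE conjE) (rule that)
qed

text \<open>If W failed, a pattern would put \<open>f\<close> in an iterated derivation of a ball of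
  radius \<open>r\<close>, with parameters adding up to at most \<open>r * M\<close>. The remaining
  \<open>r\<close> in \<open>(M + 1) * r\<close> dominates the norm of \<open>f\<close>, so only
  rounding errors are left.\<close>

lemma (in real_nspace) controls_summable:
  assumes M: "summable_szlenk_with M X" "0 \<le> M" and f: "f \<in> dual_ball X" and \<delta>: "0 < \<delta>"
  shows "controls X (M + 1) n f (\<delta> - dual_norm X f)"
proof (rule ccontr)
  assume nc: "\<not> ?thesis"
  \<comment> \<open>The rounding errors are one \<open>\<eta>\<close> per step and
    \<open>M + 1\<close> of them for the radius; this choice keeps their total below
    \<open>\<delta>\<close>.\<close>
  define \<eta> where "\<eta> = \<delta> / (n + M + 2)"
  have \<eta>: "0 < \<eta>" using \<delta> M(2) by (simp add: \<eta>_def)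
  have C: "0 \<le> M + 1" using M by simp
  obtain as r where p: "set as \<subseteq> grid \<eta> 2" "0 < r"
    "f \<in> foldr (\<lambda>a K. if a = 0 then K else szlenk X a K) as (dual_cball X r)"
    "\<delta> - dual_norm X f \<le> sum_list as + n * \<eta> - (M + 1) * (r - \<eta>)"
    by (rule not_controls_pattern[OF \<eta> C f nc])
  let ?as = "filter (\<lambda>a. a \<noteq> 0) as"
  have fr: "f \<in> foldr (szlenk X) ?as (dual_cball X r)" using p(3) unfolding foldr_szlenk_nonzero .
  have "\<forall>e\<in>set ?as. 0 < e" using p(1) grid_nonneg[OF \<eta>] by (force simp: less_le)
  then have "sum_list ?as \<le> r * M" by (rule sum_list_le_of_foldr_szlenk_cball[OF M p(2) _ fr])
  moreover have "sum_list ?as = sum_list as" by (induction as) auto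
  moreover have "dual_norm X f \<le> r"
    using fr foldr_szlenk_subset[of X ?as "dual_cball X r"] by (auto simp: dual_cball_def)
  ultimately have "\<delta> \<le> (n + M + 1) * \<eta>" using p(4) by (simp add: algebra_simps)
  also have "\<dots> < (n + M + 2) * \<eta>" using \<eta> by simp
  also have "\<dots> = \<delta>" using M(2) by (simp add: \<eta>_def)
  finally show False by simp
qed


section \<open>Coordinates of a functional on the \<open>c\<^sub>0\<close>-sum\<close>

definition single :: "(nat \<Rightarrow> 'a nspace) \<Rightarrow> nat \<Rightarrow> 'a \<Rightarrow> nat \<Rightarrow> 'a" where
  "single X i v = (\<lambda>n. if n = i then v else vzero (X n))"

text \<open>The i-th component of a functional when the dual of the c_0-sum is viewed as an
  l_1-sum.\<close>

definition coord :: "(nat \<Rightarrow> 'a nspace) \<Rightarrow> nat \<Rightarrow> ((nat \<Rightarrow> 'a) \<Rightarrow> real) \<Rightarrow> 'a \<Rightarrow> real" where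
  "coord X i h = restrict (\<lambda>v. h (single X i v)) (vecs (X i))"

definition truncate :: "(nat \<Rightarrow> 'a nspace) \<Rightarrow> nat \<Rightarrow> (nat \<Rightarrow> 'a) \<Rightarrow> nat \<Rightarrow> 'a" where
  "truncate X N x = (\<lambda>n. if n < N then x n else vzero (X n))"

lemma mem_c0_sum_iff:
  "x \<in> vecs (c0_sum X) \<longleftrightarrow> (\<forall>n. x n \<in> vecs (X n)) \<and> (\<lambda>n. vnorm (X n) (x n)) \<longlonglongrightarrow> 0"
  by (simp add: c0_sum_def)

lemma c0_sum_ops:
  "vadd (c0_sum X) x y = (\<lambda>n. vadd (X n) (x n) (y n))"
  "vscale (c0_sum X) c x = (\<lambda>n. vscale (X n) c (x n))"
  by (simp_all add: c0_sum_def)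

locale real_nspace_seq =
  fixes X :: "nat \<Rightarrow> 'a nspace"
  assumes space: "real_nspace (X n)"
begin

sublocale S: real_nspace "X n" for n
  by (rule space)

sublocale C: real_nspace "c0_sum X"
  by (intro real_nspace_c0_sum space)

lemma scale_zero_right: "vscale (X n) c (vzero (X n)) = vzero (X n)"
  using S.norm_scale[OF S.zero_closed, of n c] S.norm_eq_zero[OF S.scale_closed[OF S.zero_closed]]
  by (simp add: S.vnorm_zero)

lemma single_mem: "v \<in> vecs (X i) \<Longrightarrow> single X i v \<in> vecs (c0_sum X)"
  unfolding mem_c0_sum_iff
  by (auto simp: single_def S.zero_closed S.vnorm_zero
      intro!: tendsto_eventually eventually_mono[OF eventually_gt_at_top[of i]])

lemma single_norm_le: "v \<in> vecs (X i) \<Longrightarrow> vnorm (c0_sum X) (single X i v) \<le> vnorm (X i) v"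
  by (rule c0_sum_norm_le) (simp add: single_def S.vnorm_zero S.norm_nonneg)

lemma truncate_mem: "(\<And>n. x n \<in> vecs (X n)) \<Longrightarrow> truncate X N x \<in> vecs (c0_sum X)"
  unfolding mem_c0_sum_iff
  by (auto simp: truncate_def S.zero_closed S.vnorm_zero
      intro!: tendsto_eventually eventually_mono[OF eventually_ge_at_top[of N]])

text \<open>The embedding \<open>single X i\<close> is linear and does not increase norms.\<close>

lemma bounded_functional_coord:
  assumes h: "bounded_functional (c0_sum X) h"
  shows "bounded_functional (X i) (coord X i h)"
  unfolding bounded_functional_def
proof (intro conjI ballI allI)
  fix v assume v: "v \<in> vecs (X i)"
  have "single X i (vadd (X i) v w) = vadd (c0_sum X) (single X i v) (single X i w)" for w
    by (auto simp: single_def c0_sum_ops fun_eq_iff S.add_zero S.zero_closed)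
  then show "coord X i h (vadd (X i) v w) = coord X i h v + coord X i h w" if "w \<in> vecs (X i)" for w
    using h v that single_mem by (simp add: coord_def bounded_functional_def S.add_closed)
  have "single X i (vscale (X i) c v) = vscale (c0_sum X) c (single X i v)" for c
    by (auto simp: single_def c0_sum_ops fun_eq_iff scale_zero_right)
  then show "coord X i h (vscale (X i) c v) = c * coord X i h v" for c
    using h v single_mem by (simp add: coord_def bounded_functional_def S.scale_closed)
next
  have "\<bar>coord X i h v\<bar> \<le> dual_norm (c0_sum X) h * vnorm (X i) v" if v: "v \<in> vecs (X i)" for v
  proof -
    have "\<bar>h (single X i v)\<bar> \<le> dual_norm (c0_sum X) h * vnorm (c0_sum X) (single X i v)"
      by (rule C.dual_norm_bound[OF h single_mem[OF v]])
    also have "\<dots> \<le> dual_norm (c0_sum X) h * vnorm (X i) v"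
      by (intro mult_left_mono single_norm_le v C.dual_norm_nonneg h)
    finally show ?thesis using v by (simp add: coord_def)
  qed
  then show "\<exists>C. \<forall>v\<in>vecs (X i). \<bar>coord X i h v\<bar> \<le> C * vnorm (X i) v" by blast
qed

lemma coord_mem_dual: "f \<in> dual (c0_sum X) \<Longrightarrow> coord X i f \<in> dual (X i)"
  using bounded_functional_coord by (simp add: mem_dual_iff) (simp add: coord_def)

lemma continuous_map_coord: "continuous_map (weak_star (c0_sum X)) (weak_star (X i)) (coord X i)"
proof (rule continuous_map_into_weak_star)
  show "continuous_map (weak_star (c0_sum X)) euclideanreal (\<lambda>f. coord X i f v)"
    if "v \<in> vecs (X i)" for v
    using that continuous_map_weak_star_eval[OF single_mem[OF that]] by (simp add: coord_def)
qed (simp add: topspace_weak_star coord_mem_dual)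

lemma dual_norm_coord_diff:
  "dual_norm (X i) (coord X i (\<lambda>x. f x - g x)) = dual_norm (X i) (\<lambda>v. coord X i f v - coord X i g v)"
  by (rule dual_norm_cong) (simp add: coord_def)

section \<open>The dual norm as the l_1-sum of the coordinate norms\<close>

lemma truncate_eq_sum_coord:
  assumes h: "bounded_functional (c0_sum X) h" and x: "\<And>n. x n \<in> vecs (X n)"
  shows "h (truncate X N x) = (\<Sum>i<N. coord X i h (x i))"
proof (induction N)
  case 0
  have "truncate X 0 x = vzero (c0_sum X)" by (simp add: truncate_def c0_sum_def)
  then show ?case using C.bounded_functional_zero[OF h] by simp
next
  case (Suc N)
  have "truncate X (Suc N) x = vadd (c0_sum X) (truncate X N x) (single X N (x N))"
    by (auto simp: truncate_def single_def c0_sum_ops fun_eq_iff less_Suc_eq S.add_zero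
        S.zero_closed x S.add_commute[OF S.zero_closed])
  then have "h (truncate X (Suc N) x) = h (truncate X N x) + h (single X N (x N))"
    using h truncate_mem[OF x] single_mem[OF x] unfolding bounded_functional_def by simp
  then show ?case using Suc x by (simp add: coord_def)
qed

text \<open>Vectors that almost norm the first \<open>N\<close> coordinates combine to a vector of
  norm at most 1, since the norm of the c_0-sum is a supremum.\<close>

lemma sum_dual_norm_coord_le:
  assumes h: "bounded_functional (c0_sum X) h"
  shows "(\<Sum>i<N. dual_norm (X i) (coord X i h)) \<le> dual_norm (c0_sum X) h"
proof (rule field_le_epsilon)
  fix \<delta> :: real assume \<delta>: "0 < \<delta>"
  define d where "d = \<delta> / (N + 1)"
  have d: "0 < d" "N * d \<le> \<delta>" using \<delta> by (auto simp: d_def field_simps)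
  \<comment> \<open>A change of sign, where needed, lets the values add up without
    cancellation.\<close>
  have "\<exists>v\<in>vecs (X i). vnorm (X i) v \<le> 1 \<and> dual_norm (X i) (coord X i h) - d \<le> coord X i h v" for i
  proof -
    obtain v where v: "v \<in> vecs (X i)" "vnorm (X i) v \<le> 1"
      "dual_norm (X i) (coord X i h) - d < \<bar>coord X i h v\<bar>"
      by (rule S.dual_norm_witness[of "dual_norm (X i) (coord X i h) - d"]) (use d in auto)
    show ?thesis
    proof (cases "0 \<le> coord X i h v")
      case True
      then show ?thesis using v by (intro bexI[of _ v]) auto
    next
      case False
      have "coord X i h (vscale (X i) (- 1) v) = - coord X i h v"
        using bounded_functional_coord[OF h, of i] v(1) unfolding bounded_functional_def by simp
      then show ?thesis using v False
        by (intro bexI[of _ "vscale (X i) (- 1) v"]) (auto simp: S.norm_scale S.scale_closed)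
    qed
  qed
  then obtain x where x: "\<And>i. x i \<in> vecs (X i)" "\<And>i. vnorm (X i) (x i) \<le> 1"
    "\<And>i. dual_norm (X i) (coord X i h) - d \<le> coord X i h (x i)"
    by metis
  have "(\<Sum>i<N. dual_norm (X i) (coord X i h)) \<le> (\<Sum>i<N. coord X i h (x i) + d)"
    by (intro sum_mono) (use x(3) in \<open>simp add: diff_le_eq\<close>)
  also have "\<dots> = h (truncate X N x) + N * d"
    by (simp add: truncate_eq_sum_coord[OF h x(1)] sum.distrib)
  also have "h (truncate X N x) \<le> dual_norm (c0_sum X) h"
  proof -
    have "vnorm (c0_sum X) (truncate X N x) \<le> 1"
      by (rule c0_sum_norm_le) (simp add: truncate_def x S.vnorm_zero)
    then show ?thesis using C.dual_norm_upper[OF h truncate_mem[OF x(1)]] by (simp add: abs_le_iff)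
  qed
  finally show "(\<Sum>i<N. dual_norm (X i) (coord X i h)) \<le> dual_norm (c0_sum X) h + \<delta>"
    using d by simp
qed

text \<open>A vector with value beyond \<open>c\<close> has a tail of small norm, so a truncation of
  it still has value beyond \<open>c\<close>. The bound \<open>N0\<close> allows the coordinates
  already in play to be included.\<close>

lemma dual_norm_less_sum_coord:
  assumes h: "bounded_functional (c0_sum X) h" and c: "c < dual_norm (c0_sum X) h"
  obtains N where "N0 \<le> N" "c < (\<Sum>i<N. dual_norm (X i) (coord X i h))"
proof -
  let ?D = "dual_norm (c0_sum X) h"
  obtain x where x: "x \<in> vecs (c0_sum X)" "vnorm (c0_sum X) x \<le> 1" "c < \<bar>h x\<bar>"
    using c by (rule C.dual_norm_witness)
  have xn: "x n \<in> vecs (X n)" for n using x(1) by (simp add: mem_c0_sum_iff)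
  \<comment> \<open>A tail of norm at most \<open>\<delta>\<close> costs less than the gap between
    \<open>c\<close> and \<open>\<bar>h x\<bar>\<close>; the added 1 keeps the denominator
    positive.\<close>
  define \<delta> where "\<delta> = (\<bar>h x\<bar> - c) / (?D + 1)"
  have D: "0 \<le> ?D" by (rule C.dual_norm_nonneg[OF h])
  have \<delta>: "0 < \<delta>" "?D * \<delta> < \<bar>h x\<bar> - c" using x D by (auto simp: \<delta>_def field_simps)
  obtain N1 where N1: "\<And>n. N1 \<le> n \<Longrightarrow> vnorm (X n) (x n) \<le> \<delta>"
    using x(1) LIMSEQ_D[of "\<lambda>n. vnorm (X n) (x n)" 0 \<delta>] \<delta>(1)
    unfolding mem_c0_sum_iff by (metis abs_le_D1 diff_zero less_imp_le real_norm_def)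
  define N where "N = max N0 N1"
  define y where "y = (\<lambda>n. if n < N then vzero (X n) else x n)"
  have y: "y \<in> vecs (c0_sum X)"
  proof -
    have "(\<lambda>n. vnorm (X n) (y n)) \<longlonglongrightarrow> 0"
      by (rule Lim_transform_eventually[of "\<lambda>n. vnorm (X n) (x n)"])
         (use x(1) in \<open>auto simp: mem_c0_sum_iff y_def
            intro!: eventually_mono[OF eventually_ge_at_top[of N]]\<close>)
    then show ?thesis by (auto simp: mem_c0_sum_iff y_def S.zero_closed xn)
  qed
  have "vadd (c0_sum X) (truncate X N x) y = x"
    by (auto simp: y_def truncate_def c0_sum_ops fun_eq_iff S.add_zero xn
        S.zero_closed S.add_commute[OF S.zero_closed])
  then have "h x = h (truncate X N x) + h y"
    using h y truncate_mem[of x, OF xn] unfolding bounded_functional_def by metis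
  moreover have "\<bar>h y\<bar> \<le> ?D * \<delta>"
  proof -
    have "vnorm (c0_sum X) y \<le> \<delta>"
      by (rule c0_sum_norm_le) (use \<delta> N1 in \<open>auto simp: y_def N_def S.vnorm_zero\<close>)
    then show ?thesis
      using C.dual_norm_bound[OF h y] mult_left_mono[OF _ D] by (meson order_trans)
  qed
  ultimately have "c < \<bar>h (truncate X N x)\<bar>" using \<delta>(2) by linarith
  also have "\<dots> \<le> (\<Sum>i<N. \<bar>coord X i h (x i)\<bar>)"
    unfolding truncate_eq_sum_coord[OF h xn] by (rule sum_abs)
  also have "\<dots> \<le> (\<Sum>i<N. dual_norm (X i) (coord X i h))"
  proof (rule sum_mono)
    fix i
    have "vnorm (X i) (x i) \<le> 1" using c0_sum_norm_ge[OF x(1), of i] x(2) by simp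
    then show "\<bar>coord X i h (x i)\<bar> \<le> dual_norm (X i) (coord X i h)"
      by (rule S.dual_norm_upper[OF bounded_functional_coord[OF h] xn])
  qed
  finally show thesis using that[of N] by (simp add: N_def)
qed

lemma coord_dual_ball: "f \<in> dual_ball (c0_sum X) \<Longrightarrow> coord X i f \<in> dual_ball (X i)"
proof -
  assume "f \<in> dual_ball (c0_sum X)"
  then have f: "f \<in> dual (c0_sum X)" "dual_norm (c0_sum X) f \<le> 1" by (auto simp: dual_ball_def)
  have "0 \<le> dual_norm (X j) (coord X j f)" for j
    by (intro S.dual_norm_nonneg bounded_functional_coord dual_bounded_functional f(1))
  then have "dual_norm (X i) (coord X i f) \<le> (\<Sum>j<Suc i. dual_norm (X j) (coord X j f))"
    by (intro member_le_sum) auto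
  also have "\<dots> \<le> 1"
    using sum_dual_norm_coord_le[OF dual_bounded_functional[OF f(1)], of "Suc i"] f(2) by simp
  finally show ?thesis using coord_mem_dual[OF f(1)] by (simp add: dual_ball_def)
qed

text \<open>W plays in finitely many coordinates, beyond which the current point is small. A coordinate
  that only becomes large later enters the game at its first large value \<open>g\<close>, having moved by about
  its norm; this is paid for by the term \<open>- \<parallel>g\<parallel>\<close> in the first assumption.\<close>

lemma foldr_szlenk_sum_bound:
  assumes C: "\<And>i n f \<delta>. f \<in> dual_ball (X i) \<Longrightarrow> 0 < \<delta> \<Longrightarrow>
      controls (X i) C n f (\<delta> - dual_norm (X i) f)"
    and C0: "0 \<le> C"
    and es: "\<forall>e\<in>set es. 0 < e" and f: "f \<in> foldr (szlenk (c0_sum X)) es (dual_ball (c0_sum X))"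
    and s: "\<And>i. i < N0 \<Longrightarrow> controls (X i) C (length es) (coord X i f) (s i)"
  shows "sum_list es / 2 \<le> C + (\<Sum>i<N0. s i)"
  using es f s
proof (induction es arbitrary: f N0 s)
  case Nil
  then have fd: "f \<in> dual (c0_sum X)" "dual_norm (c0_sum X) f \<le> 1" by (auto simp: dual_ball_def)
  \<comment> \<open>With no moves left, \<open>s i\<close> is at least \<open>- C\<close> times the
    i-th coordinate norm, and these norms add up to at most 1.\<close>
  have "(\<Sum>i<N0. dual_norm (X i) (coord X i f)) \<le> 1"
    using sum_dual_norm_coord_le[OF dual_bounded_functional[OF fd(1)], of N0] fd(2) by simp
  then have "C * (\<Sum>i<N0. dual_norm (X i) (coord X i f)) \<le> C * 1" using C0 by (rule mult_left_mono)
  moreover have "(\<Sum>i<N0. - C * dual_norm (X i) (coord X i f)) \<le> (\<Sum>i<N0. s i)"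
    by (intro sum_mono) (use Nil.prems(3) in auto)
  ultimately show ?case by (simp add: sum_distrib_left sum_negf)
next
  case (Cons e es)
  let ?B = "dual_ball (c0_sum X)" and ?K = "foldr (szlenk (c0_sum X)) es (dual_ball (c0_sum X))"
  let ?n = "\<lambda>i f. dual_norm (X i) (coord X i f)"
  have fS: "f \<in> szlenk (c0_sum X) e ?K" and e: "0 < e" "\<forall>e\<in>set es. 0 < e" using Cons.prems by auto
  have KB: "?K \<subseteq> ?B" by (rule foldr_szlenk_subset)
  then have fB: "f \<in> ?B" using fS szlenk_subset by blast
  then have fd: "f \<in> dual (c0_sum X)" "dual_norm (c0_sum X) f \<le> 1" by (auto simp: dual_ball_def)
  have nonneg: "0 \<le> ?n i g" if "g \<in> dual (c0_sum X)" for g i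
    using that by (intro S.dual_norm_nonneg bounded_functional_coord dual_bounded_functional)
  have summ: "summable (\<lambda>i. ?n i f)"
  proof (rule bounded_imp_summable)
    show "(\<Sum>i\<le>n. ?n i f) \<le> 1" for n
      using sum_dual_norm_coord_le[OF dual_bounded_functional[OF fd(1)], of "Suc n"] fd(2)
      by (simp add: lessThan_Suc_atMost)
  qed (rule nonneg[OF fd(1)])
  show ?case
  proof (rule field_le_epsilon)
    fix \<delta> :: real assume \<delta>: "0 < \<delta>"
    \<comment> \<open>One third is for the errors of newly entered coordinates and one for the tail
      of \<open>f\<close>; the last is slack.\<close>
    define d where "d = \<delta> / 3"
    have d: "0 < d" using \<delta> by (simp add: d_def)
    from summ[unfolded summable_Cauchy, rule_format, OF d] obtain N1 where
      N1: "\<forall>m\<ge>N1. \<forall>n. norm (\<Sum>i=m..<n. ?n i f) < d" ..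
    define N where "N = max N0 N1"
    \<comment> \<open>Geometric error allowances stay within \<open>d\<close> in total, however many
      coordinates enter.\<close>
    define r :: "nat \<Rightarrow> real" where "r = (\<lambda>i. d * (1/2) ^ Suc i)"
    have r: "0 < r i" "(\<Sum>i<n. r i) \<le> d" for i n
    proof -
      show "0 < r i" using d by (simp add: r_def)
      have "(\<Sum>i<n. r i) = d * (1 - (1/2) ^ n)"
        by (induction n) (auto simp: r_def algebra_simps)
      also have "\<dots> \<le> d" using d by (simp add: algebra_simps)
      finally show "(\<Sum>i<n. r i) \<le> d" .
    qed
    \<comment> \<open>The coordinates from \<open>N0\<close> up to \<open>N\<close> enter the game
      now, at the point \<open>f\<close>.\<close>
    define t where "t = (\<lambda>i. if i < N0 then s i else r i - ?n i f)"
    have "controls (X i) C (Suc (length es)) (coord X i f) (t i)" for i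
      using Cons.prems(3)[of i] C[OF coord_dual_ball[OF fB] r(1), of i "Suc (length es)"]
      by (simp add: t_def del: controls.simps)
    then have "\<forall>i. \<exists>U. openin (weak_star (X i)) U \<and> coord X i f \<in> U \<and> (\<forall>g\<in>U \<inter> dual_ball (X i).
        controls (X i) C (length es) g (t i - dual_norm (X i) (\<lambda>x. coord X i f x - g x)))"
      by simp
    from choice[OF this] obtain U where U0: "\<forall>i. openin (weak_star (X i)) (U i) \<and>
        coord X i f \<in> U i \<and> (\<forall>g\<in>U i \<inter> dual_ball (X i). controls (X i) C (length es) g
          (t i - dual_norm (X i) (\<lambda>x. coord X i f x - g x)))" ..
    then have U: "openin (weak_star (X i)) (U i)" "coord X i f \<in> U i"
      "g \<in> U i \<Longrightarrow> g \<in> dual_ball (X i) \<Longrightarrow> controls (X i) C (length es) g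
        (t i - dual_norm (X i) (\<lambda>x. coord X i f x - g x))" for i g
      by simp_all
    \<comment> \<open>Only finitely many coordinates are constrained, which makes \<open>V\<close>
      weak* open.\<close>
    define V where "V = topspace (weak_star (c0_sum X)) \<inter>
      (\<Inter>i\<in>{..<N}. {g \<in> topspace (weak_star (c0_sum X)). coord X i g \<in> U i})"
    have Vo: "openin (weak_star (c0_sum X)) V"
      unfolding V_def
      by (cases "N = 0") (auto intro!: openin_Int openin_INT2
          openin_continuous_map_preimage[OF continuous_map_coord] U(1))
    have fV: "f \<in> V" using U(2) fd by (simp add: V_def topspace_weak_star)
    have Kd: "?K \<subseteq> dual (c0_sum X)" using KB dual_ball_subset by (rule order_trans)
    obtain g where g: "g \<in> ?K" "g \<in> V" "e / 2 < dual_norm (c0_sum X) (\<lambda>x. f x - g x)"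
      by (rule C.szlenk_half[OF less_imp_le[OF e(1)] fS Kd Vo fV])
    have gB: "g \<in> ?B" and gd: "g \<in> dual (c0_sum X)" using g(1) KB Kd by auto
    let ?m = "\<lambda>i. dual_norm (X i) (\<lambda>x. coord X i f x - coord X i g x)"
    obtain N' where N': "N \<le> N'" "e / 2 < (\<Sum>i<N'. ?m i)"
      by (rule dual_norm_less_sum_coord[OF bounded_functional_diff
            [OF fd(1)[THEN dual_bounded_functional] gd[THEN dual_bounded_functional]] g(3),
            unfolded dual_norm_coord_diff])
    \<comment> \<open>Coordinates below \<open>N\<close> pay for the move from \<open>f\<close> to
      \<open>g\<close>; the others enter at \<open>g\<close>.\<close>
    define u where "u = (\<lambda>i. if i < N then t i - ?m i else r i - ?n i g)"
    have "controls (X i) C (length es) (coord X i g) (u i)" for i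
      using U(3)[of "coord X i g" i] coord_dual_ball[OF gB, of i] C[OF coord_dual_ball[OF gB] r(1)] g(2)
      by (simp add: u_def V_def)
    then have "sum_list es / 2 \<le> C + (\<Sum>i<N'. u i)" by (rule Cons.IH[OF e(2) g(1)])
    moreover have "(\<Sum>i<N'. u i) + (\<Sum>i<N'. ?m i) \<le> (\<Sum>i<N0. s i) + \<delta>"
    proof -
      \<comment> \<open>From \<open>N\<close> on, the norm of the coordinate of \<open>g\<close>
        cancels against the term in \<open>u i\<close>. What remains belongs to the tail of
        \<open>f\<close>, of total less than \<open>d\<close>.\<close>
      have tri: "?m i \<le> ?n i g + ?n i f" for i
        using fd(1) gd
        by (intro S.dual_norm_diff_le bounded_functional_coord dual_bounded_functional)
      have "(\<Sum>i<N'. u i + ?m i) \<le> (\<Sum>i<N'. (if i < N0 then s i else 0) + r i + (if i < N then 0 else ?n i f))"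
      proof (rule sum_mono)
        fix i
        show "u i + ?m i \<le> (if i < N0 then s i else 0) + r i + (if i < N then 0 else ?n i f)"
          using tri[of i] r(1)[of i] nonneg[OF fd(1), of i] by (auto simp: u_def t_def N_def)
      qed
      also have "\<dots> = (\<Sum>i<N0. s i) + (\<Sum>i<N'. r i) + (\<Sum>i=N..<N'. ?n i f)"
      proof -
        have "{i \<in> {..<N'}. i < N0} = {..<N0}" "{i \<in> {..<N'}. \<not> i < N} = {N..<N'}"
          using N'(1) by (auto simp: N_def)
        then show ?thesis by (simp add: sum.distrib sum.If_cases Int_def)
      qed
      also have "\<dots> \<le> (\<Sum>i<N0. s i) + d + d"
        using r(2)[of N'] N1[rule_format, of N N'] by (simp add: N_def)
      finally show ?thesis using d by (simp add: sum.distrib d_def)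
    qed
    ultimately show "sum_list (e # es) / 2 \<le> C + (\<Sum>i<N0. s i) + \<delta>" using N'(2) by simp
  qed
qed

end

theorem theorem3p2:
  fixes X :: "nat \<Rightarrow> 'a nspace"
  assumes "\<And>n. banach_nspace (X n)"
    and "\<And>n. separable_nspace (X n)"
    and "\<exists>M. \<forall>n. summable_szlenk_with M (X n)"
  shows "summable_szlenk (c0_sum X)"
proof -
  interpret real_nspace_seq X
    by (intro real_nspace_seq.intro banach_nspace.axioms(1) assms(1))
  obtain M0 where "\<And>n. summable_szlenk_with M0 (X n)" using assms(3) by blast
  \<comment> \<open>The constant is enlarged to be nonnegative, as \<open>controls_summable\<close>
    requires.\<close>
  then have M: "summable_szlenk_with (max M0 0) (X n)" for n
    unfolding summable_szlenk_with_def by (meson max.coboundedI1)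
  have "summable_szlenk_with (2 * (max M0 0 + 1)) (c0_sum X)"
    unfolding summable_szlenk_with_def
  proof (intro allI impI, elim conjE)
    fix es :: "real list"
    assume es: "\<forall>e\<in>set es. 0 < e" "foldr (szlenk (c0_sum X)) es (dual_ball (c0_sum X)) \<noteq> {}"
    then obtain f where f: "f \<in> foldr (szlenk (c0_sum X)) es (dual_ball (c0_sum X))" by blast
    \<comment> \<open>At the start no coordinate is in play, so the sum is empty and only the
      constant remains.\<close>
    have "sum_list es / 2 \<le> (max M0 0 + 1) + (\<Sum>i<(0::nat). 0)"
    proof (rule foldr_szlenk_sum_bound[OF _ _ es(1) f])
      show "controls (X i) (max M0 0 + 1) n f (\<delta> - dual_norm (X i) f)"
        if "f \<in> dual_ball (X i)" "0 < \<delta>" for i n f \<delta>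
        using S.controls_summable[OF M _ that] by simp
    qed simp_all
    then show "sum_list es \<le> 2 * (max M0 0 + 1)" by simp
  qed
  then show ?thesis unfolding summable_szlenk_def by blast
qed

end
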